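(* Let $S$ be a symbolic word on the lattice $\mathbb{Z}^n$ over a finite alphabet, in which $A$ different symbols occur, and for each integer $m\ge1$ let $N_S(m)$ be the number of different symbol patterns in $S$ over all lattice cubes with $m$ lattice points along each side. If, for some integer $m\ge1$, $$N_S(m) < m+A-1,$$ then $S$ is fully periodic, with a full rank period lattice $\Lambda\subset\mathbb{Z}^n$.
   Context: A symbolic word on $\mathbb{Z}^n$ over a finite alphabet $\mathcal{A}$ is a function $S:\mathbb{Z}^n\to\mathcal{A}$, i.e. $S\in\mathcal{A}^{\mathbb{Z}^n}$. A lattice cube with $m$ lattice points along each side is a set $\mathbf{a}+\{0,1,\dots,m-1\}^n$ with $\mathbf{a}\in\mathbb{Z}^n$; the symbol pattern of $S$ on it is the function $\{0,\dots,m-1\}^n\to\mathcal{A}$, $\mathbf{v}\mapsto S(\mathbf{a}+\mathbf{v})$ (so patterns are compared up to translation). $S$ is fully periodic if there is a full rank lattice $\Lambda\subset\mathbb{Z}^n$ such that $S(\mathbf{v}+\boldsymbol{\lambda})=S(\mathbf{v})$ for all $\mathbf{v}\in\mathbb{Z}^n$ and $\boldsymbol{\lambda}\in\Lambda$. *)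

theory Defs
  imports "HOL-Analysis.Analysis"
begin

definition cube :: "nat \<Rightarrow> (int ^ 'n) set" where
  "cube m = {v. \<forall>i. 0 \<le> v $ i \<and> v $ i < int m}"

text \<open>The pattern on the translated cube is pulled back to \<open>cube m\<close>, so patterns are compared up
  to translation; it is extensional outside the cube, so distinct values here are distinct functions
  on \<open>cube m\<close>.\<close>

definition pattern :: "(int ^ 'n \<Rightarrow> 'a) \<Rightarrow> nat \<Rightarrow> int ^ 'n \<Rightarrow> (int ^ 'n \<Rightarrow> 'a)" where
  "pattern S m a = restrict (\<lambda>v. S (a + v)) (cube m)"

text \<open>The set below is finite whenever \<open>range S\<close> is finite, so \<open>card\<close> is then a genuine count.\<close>

definition pattern_count :: "(int ^ 'n \<Rightarrow> 'a) \<Rightarrow> nat \<Rightarrow> nat" where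
  "pattern_count S m = card (range (pattern S m))"

definition real_vec :: "int ^ 'n \<Rightarrow> real ^ 'n" where
  "real_vec v = (\<chi> i. real_of_int (v $ i))"

text \<open>The integer combinations of \<open>n\<close> vectors of \<open>\<int>\<^sup>n\<close> that are linearly independent in \<open>\<real>\<^sup>n\<close>.\<close>

definition full_rank_lattice :: "(int ^ 'n) set \<Rightarrow> bool" where
  "full_rank_lattice L \<longleftrightarrow>
     (\<exists>B. finite B \<and> card B = CARD('n) \<and> independent (real_vec ` B) \<and>
          L = {(\<Sum>b\<in>B. c b *s b) | c. True})"

definition fully_periodic :: "(int ^ 'n \<Rightarrow> 'a) \<Rightarrow> bool" where
  "fully_periodic S \<longleftrightarrow>
     (\<exists>L. full_rank_lattice L \<and> (\<forall>v. \<forall>l\<in>L. S (v + l) = S v))"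

end

theory Submission
  imports Defs "HOL-Combinatorics.Cycles"
begin

text \<open>
  Write \<open>N(k)\<close> for the number of patterns on cubes of side \<open>k\<close>. Since \<open>N\<close> is nondecreasing and
  \<open>N(1) \<ge> A\<close>, the bound \<open>N(m) < m + A - 1\<close> rules out that \<open>N\<close> increases at each of the steps
  from \<open>1\<close> to \<open>m\<close>; so \<open>N(k + 1) = N(k)\<close> for some \<open>k \<ge> 1\<close> (lemma \<open>ex_stationary_side\<close>).

  For such a \<open>k\<close> the pattern on a cube of side \<open>k\<close> at a point \<open>a\<close> extends in only one way to side
  \<open>k + 1\<close>, and the larger cube contains the cubes of side \<open>k\<close> at all the points \<open>a + e\<^sub>i\<close>. Hence the
  pattern at \<open>a\<close> determines the pattern at \<open>a + e\<^sub>i\<close> (lemma \<open>pattern_shift_determined\<close>), which makes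
  translation by \<open>e\<^sub>i\<close> act on the finite set of patterns of side \<open>k\<close>. The action is surjective,
  because \<open>a\<close> is itself a translate of \<open>a - e\<^sub>i\<close>; so it is a permutation and some positive power
  \<open>t\<^sub>i\<close> of it is the identity (lemma \<open>determined_shift_imp_period\<close>). Reading off the value at the corner of
  the cube shows that \<open>t\<^sub>i e\<^sub>i\<close> is a period of \<open>S\<close>, and the vectors \<open>t\<^sub>i e\<^sub>i\<close> span a full rank lattice.
\<close>

lemma finite_cube: "finite (cube m :: (int ^ 'n) set)"
proof (rule finite_subset)
  show "(cube m :: (int ^ 'n) set) \<subseteq> vec_lambda ` (PiE UNIV (\<lambda>_. {0..<int m}))"
  proof
    fix v :: "int ^ 'n" assume "v \<in> cube m"
    then show "v \<in> vec_lambda ` (PiE UNIV (\<lambda>_. {0..<int m}))"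
      by (intro image_eqI[of _ _ "vec_nth v"]) (auto simp: cube_def)
  qed
  show "finite (vec_lambda ` (PiE (UNIV :: 'n set) (\<lambda>_. {0..<int m})))"
    by (intro finite_imageI finite_PiE) auto
qed

lemma finite_range_pattern:
  fixes S :: "int ^ 'n \<Rightarrow> 'a"
  assumes "finite (range S)"
  shows "finite (range (pattern S m))"
proof (rule finite_subset)
  show "range (pattern S m) \<subseteq> PiE (cube m) (\<lambda>_. range S)"
    by (auto simp: pattern_def)
  show "finite (PiE (cube m :: (int ^ 'n) set) (\<lambda>_. range S))"
    using assms finite_cube by (intro finite_PiE) auto
qed

lemma pattern_eq_iff:
  "pattern S m a = pattern S m b \<longleftrightarrow> (\<forall>v \<in> cube m. S (a + v) = S (b + v))"
  by (auto simp: pattern_def restrict_def fun_eq_iff)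

lemma pattern_eq_imp_corner_eq:
  assumes "pattern S m a = pattern S m b" and "m \<ge> 1"
  shows "S a = S b"
proof -
  have "0 \<in> cube m"
    using assms(2) by (simp add: cube_def)
  with assms(1) show ?thesis
    by (metis pattern_eq_iff add.right_neutral)
qed

lemma restrict_pattern_Suc: "restrict (pattern S (Suc k) a) (cube k) = pattern S k a"
  by (auto simp: pattern_def restrict_def fun_eq_iff cube_def; smt (verit))

lemma range_pattern_eq_restrict_image:
  "range (pattern S k) = (\<lambda>q. restrict q (cube k)) ` range (pattern S (Suc k))"
  by (simp add: image_image restrict_pattern_Suc)

lemma pattern_count_le_Suc:
  assumes "finite (range S)"
  shows "pattern_count S k \<le> pattern_count S (Suc k)"
  unfolding pattern_count_def range_pattern_eq_restrict_image[of S k]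
  by (rule card_image_le[OF finite_range_pattern[OF assms]])

lemma card_range_le_pattern_count_1:
  fixes S :: "int ^ 'n \<Rightarrow> 'a"
  assumes "finite (range S)"
  shows "card (range S) \<le> pattern_count S 1"
proof -
  have "range S = (\<lambda>q. q 0) ` range (pattern S 1)"
    by (simp add: image_image pattern_def cube_def)
  then show ?thesis
    unfolding pattern_count_def by (metis card_image_le finite_range_pattern[OF assms])
qed

lemma ex_stationary_side:
  fixes S :: "int ^ 'n \<Rightarrow> 'a"
  assumes fin: "finite (range S)" and "m \<ge> 1"
    and few: "int (pattern_count S m) < int m + int (card (range S)) - 1"
  shows "\<exists>k \<ge> 1. pattern_count S (Suc k) = pattern_count S k"
proof (rule ccontr)
  assume "\<not> ?thesis"
  then have increase: "pattern_count S k < pattern_count S (Suc k)" if "k \<ge> 1" for k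
    using pattern_count_le_Suc[OF fin, of k] that by force
  have "int m + int (card (range S)) - 1 \<le> int (pattern_count S m)"
    using \<open>m \<ge> 1\<close>
  proof (induction m rule: dec_induct)
    case base
    then show ?case using card_range_le_pattern_count_1[OF fin] by simp
  next
    case (step k)
    then show ?case using increase[of k] by simp
  qed
  with few show False by simp
qed

text \<open>
  Restriction from side \<open>k + 1\<close> to side \<open>k\<close> is a surjection between finite sets of equal size, hence
  injective; and the cube of side \<open>k + 1\<close> at \<open>a\<close> contains the translate by \<open>e\<^sub>i\<close> of the one of
  side \<open>k\<close>.
\<close>
lemma pattern_shift_determined:
  fixes S :: "int ^ 'n \<Rightarrow> 'a"
  assumes fin: "finite (range S)"
    and stat: "pattern_count S (Suc k) = pattern_count S k"
    and eq: "pattern S k a = pattern S k b"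
  shows "pattern S k (a + axis i 1) = pattern S k (b + axis i 1)"
proof -
  have "inj_on (\<lambda>q. restrict q (cube k)) (range (pattern S (Suc k)))"
    using stat unfolding pattern_count_def range_pattern_eq_restrict_image[of S k]
    by (intro eq_card_imp_inj_on finite_range_pattern[OF fin]) simp
  then have "pattern S (Suc k) a = pattern S (Suc k) b"
    by (rule inj_onD) (simp_all add: restrict_pattern_Suc eq)
  then have big: "S (a + v) = S (b + v)" if "v \<in> cube (Suc k)" for v
    using that by (simp add: pattern_eq_iff)
  show ?thesis
    unfolding pattern_eq_iff
  proof
    fix v :: "int ^ 'n" assume "v \<in> cube k"
    then have "axis i 1 + v \<in> cube (Suc k)"
      unfolding cube_def axis_def by (simp, smt (verit))
    from big[OF this] show "S (a + axis i 1 + v) = S (b + axis i 1 + v)"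
      by (simp add: add.assoc)
  qed
qed

text \<open>
  The hypothesis turns translation by \<open>u\<close> into a self-map of the finite set of values of \<open>p\<close>. That
  map is onto, since every value \<open>p a\<close> comes from \<open>p (a - u)\<close>; being a permutation of a finite set,
  it has finite order.
\<close>
lemma determined_shift_imp_period:
  fixes p :: "int ^ 'n \<Rightarrow> 'b"
  assumes fin: "finite (range p)"
    and det: "\<And>a b. p a = p b \<Longrightarrow> p (a + u) = p (b + u)"
  shows "\<exists>t>0. \<forall>a. p (a + int t *s u) = p a"
proof -
  define f where "f q = (if q \<in> range p then p (inv p q + u) else q)" for q
  have f: "f (p a) = p (a + u)" for a
    unfolding f_def using det[of "inv p (p a)" a] by (simp add: f_inv_into_f)
  have "f ` range p = range p"
  proof
    show "f ` range p \<subseteq> range p" by (auto simp: f)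
    show "range p \<subseteq> f ` range p"
    proof
      fix q assume "q \<in> range p"
      then obtain a where "q = p a" by blast
      then have "q = f (p (a - u))" by (simp add: f)
      then show "q \<in> f ` range p" by blast
    qed
  qed
  then have "bij_betw f (range p) (range p)"
    using fin by (simp add: bij_betw_def eq_card_imp_inj_on)
  then have "f permutes range p"
    by (rule bij_imp_permutes) (simp add: f_def)
  with fin have "permutation f"
    by (auto simp: permutation_permutes)
  then obtain t where t: "f ^^ t = id" "t > 0"
    using permutation_is_nilpotent by blast
  have "(f ^^ s) (p a) = p (a + int s *s u)" for s a
    by (induction s) (simp_all add: f vector_sadd_rdistrib add_ac)
  with t show ?thesis
    by (metis id_apply)
qed

lemma period_int_multiple:
  fixes S :: "int ^ 'n \<Rightarrow> 'a"
  assumes per: "\<And>v. S (v + l) = S v"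
  shows "S (v + c *s l) = S v"
proof (induction c arbitrary: v rule: int_induct[where k = 0])
  case base
  then show ?case by simp
next
  case (step1 c)
  then show ?case
    using per[of "v + c *s l"] by (simp add: vector_sadd_rdistrib add_ac)
next
  case (step2 c)
  then show ?case
    using per[of "v + (c - 1) *s l"] by (simp add: vector_sadd_rdistrib algebra_simps)
qed

lemma period_sum_multiples:
  fixes S :: "int ^ 'n \<Rightarrow> 'a"
  assumes "finite B" and "\<And>b v. b \<in> B \<Longrightarrow> S (v + b) = S v"
  shows "S (v + (\<Sum>b\<in>B. c b *s b)) = S v"
  using assms
proof (induction B arbitrary: v rule: finite_induct)
  case empty
  then show ?case by simp
next
  case (insert b B)
  have "S (v + (\<Sum>b\<in>insert b B. c b *s b)) = S ((v + c b *s b) + (\<Sum>b\<in>B. c b *s b))"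
    using insert.hyps by (simp add: add.assoc)
  also have "\<dots> = S (v + c b *s b)"
    using insert.IH insert.prems by blast
  also have "\<dots> = S v"
    using insert.prems by (intro period_int_multiple) simp
  finally show ?case .
qed

lemma fully_periodic_if_axis_periods:
  fixes S :: "int ^ 'n \<Rightarrow> 'a" and t :: "'n \<Rightarrow> int"
  assumes pos: "\<And>i. t i > 0" and per: "\<And>i v. S (v + axis i (t i)) = S v"
  shows "fully_periodic S"
proof -
  define B where "B = range (\<lambda>i. axis i (t i))"
  have inj: "inj (\<lambda>i. axis i (t i))"
    using pos by (auto simp: inj_def axis_eq_axis less_le)
  have real_axis: "real_vec (axis i (t i)) = axis i (real_of_int (t i))" for i
    by (simp add: real_vec_def axis_def vec_eq_iff)
  have "pairwise orthogonal (real_vec ` B)"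
    by (auto simp: pairwise_def B_def real_axis orthogonal_def inner_axis_axis)
  moreover have "0 \<notin> real_vec ` B"
    using pos by (auto simp: B_def real_axis axis_eq_0_iff less_le dest: sym)
  ultimately have "independent (real_vec ` B)"
    by (rule pairwise_orthogonal_independent)
  moreover have "finite B" "card B = CARD('n)"
    using inj by (simp_all add: B_def card_image)
  ultimately have "full_rank_lattice {(\<Sum>b\<in>B. c b *s b) | c. True}"
    unfolding full_rank_lattice_def by blast
  moreover have "S (v + (\<Sum>b\<in>B. c b *s b)) = S v" for v c
    using \<open>finite B\<close> per by (intro period_sum_multiples) (auto simp: B_def)
  ultimately show ?thesis
    unfolding fully_periodic_def by blast
qed

theorem theorem4p1:
  fixes S :: "int ^ 'n \<Rightarrow> 'a" and alphabet :: "'a set" and m :: nat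
  assumes "finite alphabet"
    and "range S \<subseteq> alphabet"
    and "m \<ge> 1"
    and "int (pattern_count S m) < int m + int (card (range S)) - 1"
  shows "fully_periodic S"
proof -
  have fin: "finite (range S)"
    using assms(1,2) by (rule rev_finite_subset)
  obtain k where k: "k \<ge> 1" "pattern_count S (Suc k) = pattern_count S k"
    using ex_stationary_side[OF fin assms(3,4)] by blast
  have "\<exists>t>0. \<forall>a. pattern S k (a + int t *s axis i 1) = pattern S k a" for i
    by (intro determined_shift_imp_period finite_range_pattern fin
        pattern_shift_determined[OF fin k(2)])
  then obtain t where t: "\<And>i. t i > 0"
      "\<And>i a. pattern S k (a + int (t i) *s axis i 1) = pattern S k a"
    by metis
  have axis: "int (t i) *s axis i 1 = axis i (int (t i))" for i :: 'n
    by (simp add: vec_eq_iff axis_def)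
  show ?thesis
  proof (rule fully_periodic_if_axis_periods)
    show "int (t i) > 0" for i
      using t(1) by simp
    show "S (v + axis i (int (t i))) = S v" for i v
      using pattern_eq_imp_corner_eq[OF t(2) k(1), of v i] by (simp add: axis)
  qed
qed

end
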